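(* Fix an arbitrary $k_0\in\mathbb{N}$. There is a sufficiently large $L_0>0$ such that for all $L\in\mathbb{N}$ with $L\ge L_0$ and all $U\in(0,\pi/4)$ the set of functions $$f_1(t)=t\sin^2 t,\quad f_2(t)=t\cos^2 t,\quad f_3(t)=t\cos(2t),\qquad t\in[\pi L,\pi L+U],$$ generates the following formula. For $i=1,2,3$ and $1\le k\le k_0$ there exist $\zeta$-factorization points $\alpha_0^{i,k},\alpha_1^{i,k},\dots,\alpha_k^{i,k}$ generated by $f_i$ and common (independent of $i$) points $\beta_1^{k},\dots,\beta_k^{k}$, in the sense defined in the context with $T=\pi L$, such that for all integers $k_1,k_2,k_3$ with $1\le k_1,k_2,k_3\le k_0$ $$\left\{\alpha_0^{2,k_2}\prod_{r=1}^{k_2}\frac{\tilde Z^2(\alpha_r^{2,k_2})}{\tilde Z^2(\beta_r^{k_2})}\right\}\cos^2\alpha_0^{2,k_2}-\left\{\alpha_0^{1,k_1}\prod_{r=1}^{k_1}\frac{\tilde Z^2(\alpha_r^{1,k_1})}{\tilde Z^2(\beta_r^{k_1})}\right\}\sin^2\alpha_0^{1,k_1}=\left\{\alpha_0^{3,k_3}\prod_{r=1}^{k_3}\frac{\tilde Z^2(\alpha_r^{3,k_3})}{\tilde Z^2(\beta_r^{k_3})}\right\}\cos(2\alpha_0^{3,k_3}),$$ where, for $i=1,2,3$, $$\alpha_0^{i,k_i}\in(\pi L,\pi L+U),\qquad \alpha_r^{i,k_i},\ \beta_r^{k_i}\in\left([\pi L]^{(r)},[\pi L+U]^{(r)}\right),\quad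 r=1,\dots,k_i.$$ In particular, with $\bar k=\max\{k_1,k_2,k_3\}\le k_0$, all these points belong to $$\Delta(U,\pi L,\bar k)=\bigcup_{r=0}^{\bar k}\left[[\pi L]^{(r)},[\pi L+U]^{(r)}\right]\subset\Delta(U,\pi L,k_0)=\bigcup_{r=0}^{k_0}\left[[\pi L]^{(r)},[\pi L+U]^{(r)}\right].$$
   Context: Jacob's ladder. Let $\zeta$ be the Riemann zeta-function and $Z^2(t)=|\zeta(\tfrac12+it)|^2$. Fix a smooth increasing function $\mu(y)\ge 7y\ln y$ (for instance $\mu(y)=7y\ln y$) and let $\varphi(T)$ be the solution $x(T)=\varphi(T)$, for large $T$, of the nonlinear integral equation $$\int_0^{\mu[x(T)]}Z^2(t)\,e^{-\frac{2t}{x(T)}}\,dt=\int_0^T Z^2(t)\,dt .$$ The Jacob's ladder is $\varphi_1(t)=\tfrac12\varphi(t)$; for all sufficiently large $t$ it is smooth, strictly increasing and unbounded. Put $$\tilde Z^2(t)=\frac{d\varphi_1(t)}{dt}=\frac{|\zeta(\frac12+it)|^2}{\omega(t)},\qquad \omega(t)=\left\{1+O\left(\frac{\ln\ln t}{\ln t}\right)\right\}\ln t .$$ Reverse iterations. For sufficiently large $x$, the $r$-th reverse iterate $[x]^{(r)}$ of $x$ by $\varphi_1$ is defined by $[x]^{(0)}=x$ and $\varphi_1([x]^{(r)})=[x]^{(r-1)}$, $r\ge1$. (The paper writes $\overset{r}{x}$ with an arc for $[x]^{(r)}$.) $\zeta$-factorization points. Let $f$ be a continuous, non-negative, not identically zero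 function on $[T,T+U]$ and $k\in\mathbb{N}$. Points $\alpha_r=\alpha_r(U,T,k;f)$, $r=0,1,\dots,k$, depending on $U,T,k,f$, together with points $\beta_r=\beta_r(U,T,k)$, $r=1,\dots,k$, depending only on $U,T,k$ (not on $f$), are called $\zeta$-factorization points generated by $f$ if $\alpha_0\in(T,T+U)$, $\alpha_r,\beta_r\in([T]^{(r)},[T+U]^{(r)})$ for $r=1,\dots,k$, $f(\alpha_0)\neq0$, $\tilde Z^2(\beta_r)\ne0$, and $$\prod_{r=1}^{k}\frac{\tilde Z^2(\alpha_r)}{\tilde Z^2(\beta_r)}=\frac{1}{f(\alpha_0)}\cdot\frac1U\int_T^{T+U}f(t)\,dt .$$ *)

theory Defs
  imports "HOL-Complex_Analysis.Complex_Analysis"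
begin

text \<open>
  The Riemann zeta-function as the analytic continuation of its Dirichlet series. The continuation
  is taken to \<open>{s. Re s > 0} - {1}\<close>, which contains the critical line; by the identity theorem it
  is unique there, so the choice operator picks a determined value at every such point.
\<close>

definition zeta_continuation :: "(complex \<Rightarrow> complex) \<Rightarrow> bool" where
  "zeta_continuation f \<longleftrightarrow>
     f holomorphic_on ({s. Re s > 0} - {1}) \<and>
     (\<forall>s. Re s > 1 \<longrightarrow> (\<lambda>n. 1 / of_nat (Suc n) powr s) sums f s)"

definition zeta :: "complex \<Rightarrow> complex" where
  "zeta = (SOME f. zeta_continuation f)"

definition Zsq :: "real \<Rightarrow> real" where
  "Zsq t = (cmod (zeta (Complex (1/2) t)))\<^sup>2"

text \<open>
  The function \<open>\<mu>\<close> is given on a half-line \<open>(y\<^sub>0, \<infinity>)\<close> with \<open>y\<^sub>0 > 0\<close>; its values outside play no role.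
  "Increasing" is taken in the weak sense and "smooth" means infinitely differentiable.
\<close>

definition admissible_mu :: "real \<Rightarrow> (real \<Rightarrow> real) \<Rightarrow> bool" where
  "admissible_mu y0 \<mu> \<longleftrightarrow>
     y0 > 0 \<and>
     (\<forall>n. (deriv ^^ n) \<mu> differentiable_on {y0<..}) \<and>
     mono_on {y0<..} \<mu> \<and>
     (\<forall>y>y0. \<mu> y \<ge> 7 * y * ln y)"

definition ladder_equation :: "(real \<Rightarrow> real) \<Rightarrow> real \<Rightarrow> real \<Rightarrow> bool" where
  "ladder_equation \<mu> T x \<longleftrightarrow>
     integral {0..\<mu> x} (\<lambda>t. Zsq t * exp (- (2 * t / x))) = integral {0..T} Zsq"

text \<open>
  The set of \<open>T > 0\<close> for which the equation has a solution. As the left-hand side increases with \<open>x\<close>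
  (strictly where it is positive), with the same limit as the right-hand side has for \<open>T \<rightarrow> \<infinity>\<close>,
  solutions are unique and this set contains all large \<open>T\<close>.
\<close>

definition ladder_domain :: "real \<Rightarrow> (real \<Rightarrow> real) \<Rightarrow> real set" where
  "ladder_domain y0 \<mu> = {T. T > 0 \<and> (\<exists>x>y0. ladder_equation \<mu> T x)}"

definition phi :: "real \<Rightarrow> (real \<Rightarrow> real) \<Rightarrow> real \<Rightarrow> real" where
  "phi y0 \<mu> T = (THE x. x > y0 \<and> ladder_equation \<mu> T x)"

definition phi1 :: "real \<Rightarrow> (real \<Rightarrow> real) \<Rightarrow> real \<Rightarrow> real" where
  "phi1 y0 \<mu> t = phi y0 \<mu> t / 2"

definition Ztsq :: "real \<Rightarrow> (real \<Rightarrow> real) \<Rightarrow> real \<Rightarrow> real" where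
  "Ztsq y0 \<mu> t = deriv (phi1 y0 \<mu>) t"

text \<open>
  The \<open>r\<close>-th reverse iterate of \<open>x\<close>. It is meaningful for \<open>x\<close> large in terms of \<open>r\<close>, when
  the successive preimages under the injective restriction of \<open>\<phi>\<^sub>1\<close> to its domain exist.
\<close>

primrec rev_iter :: "real \<Rightarrow> (real \<Rightarrow> real) \<Rightarrow> nat \<Rightarrow> real \<Rightarrow> real" where
  "rev_iter y0 \<mu> 0 x = x"
| "rev_iter y0 \<mu> (Suc r) x = the_inv_into (ladder_domain y0 \<mu>) (phi1 y0 \<mu>) (rev_iter y0 \<mu> r x)"

text \<open>
  Here \<open>\<alpha> r\<close> is used for \<open>0 \<le> r \<le> k\<close> and \<open>\<beta> r\<close> for \<open>1 \<le> r \<le> k\<close>. That \<open>\<beta>\<close> does not depend on the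
  generating function \<open>f\<close> is expressed by the order of quantifiers where this predicate is used.
\<close>

definition zeta_factorization_points ::
  "real \<Rightarrow> (real \<Rightarrow> real) \<Rightarrow> real \<Rightarrow> real \<Rightarrow> nat \<Rightarrow> (real \<Rightarrow> real) \<Rightarrow>
     (nat \<Rightarrow> real) \<Rightarrow> (nat \<Rightarrow> real) \<Rightarrow> bool" where
  "zeta_factorization_points y0 \<mu> U T k f \<alpha> \<beta> \<longleftrightarrow>
     continuous_on {T..T+U} f \<and> (\<forall>t\<in>{T..T+U}. f t \<ge> 0) \<and> (\<exists>t\<in>{T..T+U}. f t \<noteq> 0) \<and>
     \<alpha> 0 \<in> {T<..<T+U} \<and>
     (\<forall>r\<in>{1..k}. \<alpha> r \<in> {rev_iter y0 \<mu> r T<..<rev_iter y0 \<mu> r (T+U)} \<and>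
                  \<beta> r \<in> {rev_iter y0 \<mu> r T<..<rev_iter y0 \<mu> r (T+U)}) \<and>
     f (\<alpha> 0) \<noteq> 0 \<and> (\<forall>r\<in>{1..k}. Ztsq y0 \<mu> (\<beta> r) \<noteq> 0) \<and>
     (\<Prod>r=1..k. Ztsq y0 \<mu> (\<alpha> r) / Ztsq y0 \<mu> (\<beta> r)) =
       1 / f (\<alpha> 0) * (1 / U * integral {T..T+U} f)"

definition Delta_set :: "real \<Rightarrow> (real \<Rightarrow> real) \<Rightarrow> real \<Rightarrow> real \<Rightarrow> nat \<Rightarrow> real set" where
  "Delta_set y0 \<mu> U T k = (\<Union>r\<in>{0..k}. {rev_iter y0 \<mu> r T..rev_iter y0 \<mu> r (T+U)})"

end

theory Submission
  imports Defs
begin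

text \<open>
  The function \<open>\<phi>\<^sub>1\<close> is a differentiable, strictly increasing bijection between two half-lines that are
  unbounded to the right, so every reverse iterate of a large point exists, and the \<open>k\<close>-th one depends
  on the point in a strictly increasing way.
  For continuous \<open>f\<close> on \<open>[T, T+U]\<close>, let \<open>H\<close> be its integral from \<open>T\<close>. The mean value theorem for
  \<open>H \<circ> \<phi>\<^sub>1 \<circ> \<dots> \<circ> \<phi>\<^sub>1\<close> (\<open>k\<close> factors) on the interval from \<open>[T]\<^sup>(\<^sup>k\<^sup>)\<close> to \<open>[T+U]\<^sup>(\<^sup>k\<^sup>)\<close> of length \<open>d\<close>
  gives a point \<open>\<alpha>\<^sub>k\<close>; with \<open>\<alpha>\<close> its successive images under \<open>\<phi>\<^sub>1\<close>, the chain rule turns the result into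
  \<open>\<integral> f = d f(\<alpha>\<^sub>0) \<Prod> \<phi>\<^sub>1'(\<alpha>\<^sub>r)\<close> (\<open>iterated_ladder_mean_value\<close>).
  The case \<open>f = 1\<close> yields points \<open>\<beta>\<^sub>r\<close> with \<open>U = d \<Prod> \<phi>\<^sub>1'(\<beta>\<^sub>r)\<close>, which know nothing of \<open>f\<close>. The quotient of
  the two identities is the factorization formula (\<open>common_beta_factorization\<close>). Hence
  \<open>f(\<alpha>\<^sub>0)\<close> times the product is the mean value of \<open>f\<close>, whatever \<open>k\<close> is, and the theorem is linearity of the
  mean value applied to \<open>t cos\<^sup>2 t - t sin\<^sup>2 t = t cos 2t\<close>.

  The facts about \<open>\<phi>\<^sub>1\<close> come from writing the defining equation as \<open>F(x) = G(T)\<close>, where \<open>F\<close> is the damped and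
  \<open>G\<close> the plain integral of \<open>Z\<^sup>2\<close>, so that \<open>\<phi> = F\<^sup>-\<^sup>1 \<circ> G\<close>. Where \<open>\<mu>(x) > 0\<close>, the derivative of \<open>F\<close> is positive,
  because both the upper limit and the damping factor increase with \<open>x\<close>. As \<open>F\<close> and \<open>G\<close>
  have the same supremum and \<open>G\<close> does not attain it, \<open>\<phi>\<close> is defined for all large \<open>T\<close> and unbounded. Of \<open>Z\<^sup>2\<close>
  the argument uses that it is continuous, non-negative and not identically zero on any interval, which
  holds because \<open>\<zeta>\<close> is analytic and \<open>\<zeta>(2) \<noteq> 0\<close>.
\<close>

section \<open>The zeta-function on the critical line\<close>

text \<open>
  For \<open>s \<noteq> 1\<close> this is \<open>m\<^sup>-\<^sup>s - \<integral> x\<^sup>-\<^sup>s dx\<close> with \<open>m = n + 1\<close> and the integral taken over \<open>[m, m + 1]\<close>.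
  Removing the integral from each term of the Dirichlet series extends convergence to \<open>Re s > 0\<close>; the integrals
  add up to \<open>1 / (s - 1)\<close>.
\<close>

definition zeta_term :: "nat \<Rightarrow> complex \<Rightarrow> complex" where
  "zeta_term n s = of_nat (Suc n) powr (-s)
     - (of_nat (Suc (Suc n)) powr (1 - s) - of_nat (Suc n) powr (1 - s)) / (1 - s)"

lemma norm_powr_diff_le:
  fixes s :: complex and x y :: real
  assumes "0 < x" "x \<le> y" "0 \<le> Re s"
  shows "norm (of_real y powr (-s) - of_real x powr (-s)) \<le> norm s * x powr (- Re s - 1) * (y - x)"
proof -
  have "norm (of_real y powr (-s) - of_real x powr (-s))
      \<le> norm s * x powr (- Re s - 1) * norm (of_real y - of_real x :: complex)"
  proof (rule field_differentiable_bound[where S = "of_real ` {x..y}"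
        and f' = "\<lambda>z. (-s) * z powr (-s - 1)"])
    show "convex (of_real ` {x..y} :: complex set)"
      by (intro convex_linear_image) (auto intro!: bounded_linear.linear bounded_linear_of_real)
  next
    fix z :: complex assume "z \<in> of_real ` {x..y}"
    then obtain t where t: "z = of_real t" "x \<le> t" "t \<le> y" by auto
    have "z \<notin> \<real>\<^sub>\<le>\<^sub>0" using t assms by (auto simp: complex_nonpos_Reals_iff)
    then show "((\<lambda>z. z powr (-s)) has_field_derivative (-s) * z powr (-s - 1))
        (at z within of_real ` {x..y})"
      by (rule has_field_derivative_at_within[OF has_field_derivative_powr])
    have "t powr (- Re s - 1) \<le> x powr (- Re s - 1)"
      using t assms by (intro powr_mono2') auto
    then show "norm ((-s) * z powr (-s - 1)) \<le> norm s * x powr (- Re s - 1)"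
      using t assms by (simp add: norm_mult norm_powr_real_powr mult_left_mono)
  qed (use assms in auto)
  then show ?thesis using assms by (simp flip: of_real_diff)
qed

text \<open>
  The term is the difference between \<open>m\<^sup>-\<^sup>s\<close> and the mean of \<open>x\<^sup>-\<^sup>s\<close> over \<open>[m, m + 1]\<close>, which is of the order of the
  derivative \<open>-s m\<^sup>-\<^sup>s\<^sup>-\<^sup>1\<close>; this gains one power of \<open>m\<close> over \<open>m\<^sup>-\<^sup>s\<close>.
\<close>

lemma norm_zeta_term_le:
  assumes "0 \<le> Re s" "s \<noteq> 1"
  shows "norm (zeta_term n s) \<le> norm s * real (Suc n) powr (- Re s - 1)"
proof -
  define m where "m = real (Suc n)"
  have m: "m > 0" by (simp add: m_def)
  define g where "g = (\<lambda>z::complex. z * of_real m powr (-s) - z powr (1 - s) / (1 - s))"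
  have "norm (g (of_real (m + 1)) - g (of_real m))
      \<le> norm s * m powr (- Re s - 1) * norm (of_real (m + 1) - of_real m :: complex)"
  proof (rule field_differentiable_bound[where S = "of_real ` {m..m+1}"
        and f' = "\<lambda>z. of_real m powr (-s) - z powr (-s)"])
    show "convex (of_real ` {m..m+1} :: complex set)"
      by (intro convex_linear_image) (auto intro!: bounded_linear.linear bounded_linear_of_real)
  next
    fix z :: complex assume "z \<in> of_real ` {m..m+1}"
    then obtain t where t: "z = of_real t" "m \<le> t" "t \<le> m + 1" by auto
    have "z \<notin> \<real>\<^sub>\<le>\<^sub>0" using t m by (auto simp: complex_nonpos_Reals_iff)
    then have "((\<lambda>z. z powr (1 - s)) has_field_derivative (1 - s) * z powr (1 - s - 1)) (at z)"
      by (rule has_field_derivative_powr)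
    then have "((\<lambda>z. z powr (1 - s) / (1 - s)) has_field_derivative
        (1 - s) * z powr (1 - s - 1) / (1 - s)) (at z)"
      by (rule DERIV_cdivide)
    then have "(g has_field_derivative (1 * of_real m powr (-s)
        - (1 - s) * z powr (1 - s - 1) / (1 - s))) (at z)"
      unfolding g_def by (rule DERIV_diff[OF DERIV_cmult_right[OF DERIV_ident]])
    then show "(g has_field_derivative (of_real m powr (-s) - z powr (-s)))
        (at z within of_real ` {m..m+1})"
      using \<open>s \<noteq> 1\<close> by (simp add: has_field_derivative_at_within)
    have "norm (of_real t powr (-s) - of_real m powr (-s)) \<le> norm s * m powr (- Re s - 1) * (t - m)"
      using t m assms by (intro norm_powr_diff_le) auto
    also have "\<dots> \<le> norm s * m powr (- Re s - 1) * 1"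
      using t by (intro mult_left_mono) auto
    finally show "norm (of_real m powr (-s) - z powr (-s)) \<le> norm s * m powr (- Re s - 1)"
      using t by (simp add: norm_minus_commute)
  qed (auto intro: image_eqI[of _ _ "m + 1"])
  moreover have "g (of_real (m + 1)) - g (of_real m) = zeta_term n s"
    by (simp add: g_def zeta_term_def m_def algebra_simps diff_divide_distrib)
  ultimately show ?thesis by (simp add: m_def)
qed

lemma zeta_term_holomorphic: "zeta_term n holomorphic_on - {1}"
  unfolding zeta_term_def by (auto intro!: holomorphic_intros)

text \<open>
  Without this the choice operator defining \<open>zeta\<close> would yield an unspecified function.
\<close>

lemma zeta_continuation_exists:
  "zeta_continuation (\<lambda>s. (\<Sum>n. zeta_term n s) + 1 / (s - 1))"
  unfolding zeta_continuation_def
proof (intro conjI allI impI)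
  let ?S = "{s. Re s > 0} - {1::complex}"
  have op: "open ?S" by (intro open_delete open_halfspace_Re_gt)
  have "(\<lambda>s. \<Sum>n. zeta_term n s) holomorphic_on ?S"
  proof (rule holomorphic_uniform_sequence[OF op, where f = "\<lambda>N s. \<Sum>n<N. zeta_term n s"])
    show "(\<lambda>s. \<Sum>n<N. zeta_term n s) holomorphic_on ?S" for N
      by (intro holomorphic_on_sum holomorphic_on_subset[OF zeta_term_holomorphic]) auto
  next
    fix z assume z: "z \<in> ?S"
    then obtain d0 where d0: "d0 > 0" "cball z d0 \<subseteq> ?S" using op open_contains_cball by blast
    \<comment> \<open>Halving \<open>Re z\<close> keeps the disc away from the imaginary axis, so one exponent serves all its points.\<close>
    define d where "d = min d0 (Re z / 2)"
    have d: "d > 0" "cball z d \<subseteq> ?S" using z d0 by (auto simp: d_def)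
    have "uniform_limit (cball z d) (\<lambda>N s. \<Sum>n<N. zeta_term n s) (\<lambda>s. \<Sum>n. zeta_term n s) sequentially"
    proof (rule Weierstrass_m_test)
      fix n s assume s: "s \<in> cball z d"
      have "\<bar>Re z - Re s\<bar> \<le> d" using s abs_Re_le_cmod[of "z - s"] by (auto simp: dist_norm)
      then have re: "Re s \<ge> Re z / 2" by (auto simp: d_def abs_le_iff min_def split: if_splits)
      have "norm s \<le> norm z + norm (s - z)" using norm_triangle_ineq[of z "s - z"] by simp
      then have no: "norm s \<le> norm z + d" using s by (simp add: dist_norm norm_minus_commute)
      have "norm (zeta_term n s) \<le> norm s * real (Suc n) powr (- Re s - 1)"
        using s d z by (intro norm_zeta_term_le) auto
      also have "\<dots> \<le> (norm z + d) * real (Suc n) powr (- (Re z / 2) - 1)"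
        using no re d by (intro mult_mono powr_mono add_nonneg_nonneg) auto
      finally show "norm (zeta_term n s) \<le> (norm z + d) * real (Suc n) powr (- (Re z / 2) - 1)" .
    next
      have "summable (\<lambda>n. real n powr (- (Re z / 2) - 1))"
        using z by (subst summable_real_powr_iff) auto
      then show "summable (\<lambda>n. (norm z + d) * real (Suc n) powr (- (Re z / 2) - 1))"
        by (intro summable_mult) (subst summable_Suc_iff)
    qed
    then show "\<exists>d>0. cball z d \<subseteq> ?S \<and>
        uniform_limit (cball z d) (\<lambda>N s. \<Sum>n<N. zeta_term n s) (\<lambda>s. \<Sum>n. zeta_term n s) sequentially"
      using d by blast
  qed
  then show "(\<lambda>s. (\<Sum>n. zeta_term n s) + 1 / (s - 1)) holomorphic_on ?S"
    by (auto intro!: holomorphic_intros)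
next
  fix s :: complex assume s: "Re s > 1"
  \<comment> \<open>The subtracted integrals are the differences of this antiderivative of \<open>x\<^sup>-\<^sup>s\<close>, so they telescope.\<close>
  define p where "p = (\<lambda>n. of_nat (Suc n) powr (1 - s) / (1 - s))"
  have "summable (\<lambda>n. norm s * real (Suc n) powr (- Re s - 1))"
    using s summable_real_powr_iff[of "- Re s - 1"]
    by (intro summable_mult) (subst summable_Suc_iff, auto)
  moreover have "norm (zeta_term n s) \<le> norm s * real (Suc n) powr (- Re s - 1)" for n
    using s by (intro norm_zeta_term_le) auto
  ultimately have "summable (\<lambda>n. zeta_term n s)"
    by (rule summable_comparison_test'[where N = 0])
  then have 1: "(\<lambda>n. zeta_term n s) sums (\<Sum>n. zeta_term n s)" by (rule summable_sums)
  have "((\<lambda>n. of_nat (Suc n) powr (1 - s)) \<longlonglongrightarrow> 0)"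
    using s by (intro tendsto_neg_powr_complex_of_nat filterlim_Suc) auto
  then have "p \<longlonglongrightarrow> 0"
    unfolding p_def by (rule tendsto_divide_zero)
  then have "(\<lambda>n. p (Suc n) - p n) sums (0 - p 0)" by (rule telescope_sums)
  with 1 have "(\<lambda>n. zeta_term n s + (p (Suc n) - p n)) sums ((\<Sum>n. zeta_term n s) + (0 - p 0))"
    by (rule sums_add)
  moreover have "zeta_term n s + (p (Suc n) - p n) = 1 / of_nat (Suc n) powr s" for n
    by (simp add: zeta_term_def p_def powr_minus field_simps diff_divide_distrib)
  moreover have "0 - p 0 = 1 / (s - 1)"
    using s by (auto simp: p_def divide_simps)
  ultimately show "(\<lambda>n. 1 / of_nat (Suc n) powr s) sums ((\<Sum>n. zeta_term n s) + 1 / (s - 1))"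
    by (simp only:)
qed

lemma zeta_continuation_zeta: "zeta_continuation zeta"
  unfolding zeta_def by (rule someI[of zeta_continuation, OF zeta_continuation_exists])

lemma zeta_holomorphic: "zeta holomorphic_on ({s. Re s > 0} - {1})"
  and zeta_sums: "Re s > 1 \<Longrightarrow> (\<lambda>n. 1 / of_nat (Suc n) powr s) sums zeta s"
  using zeta_continuation_zeta by (auto simp: zeta_continuation_def)

lemma zeta_2_nonzero: "zeta 2 \<noteq> 0"
proof
  assume "zeta 2 = 0"
  then have "(\<lambda>n. 1 / of_nat (Suc n) powr (2::complex)) sums 0" using zeta_sums[of 2] by simp
  then have "(\<lambda>n. Re (1 / of_nat (Suc n) powr 2)) sums Re 0" by (rule sums_Re)
  moreover have "Re (1 / of_nat (Suc n) powr 2) = 1 / (real (Suc n))\<^sup>2" for n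
  proof -
    have "of_nat (Suc n) powr (2::complex) = complex_of_real ((real (Suc n))\<^sup>2)"
      by (subst powr_complexnumeral) (auto simp del: of_nat_Suc)
    then show ?thesis by (simp add: Re_divide_of_real del: of_nat_Suc of_real_power)
  qed
  ultimately have s: "(\<lambda>n. 1 / (real (Suc n))\<^sup>2) sums 0" by simp
  then have "0 < (\<Sum>n. 1 / (real (Suc n))\<^sup>2)"
    by (intro suminf_pos sums_summable[OF s]) simp
  with s show False by (simp add: sums_iff)
qed

lemma continuous_on_Zsq: "continuous_on A Zsq"
proof -
  have "continuous_on UNIV (\<lambda>t. zeta (Complex (1/2) t))"
    by (rule continuous_on_compose2[OF holomorphic_on_imp_continuous_on[OF zeta_holomorphic]])
      (auto simp: complex_eq_iff Complex_eq intro!: continuous_intros)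
  then have "continuous_on UNIV Zsq" unfolding Zsq_def by (intro continuous_intros)
  then show ?thesis by (rule continuous_on_subset) auto
qed

lemma Zsq_nonneg: "Zsq t \<ge> 0" by (simp add: Zsq_def)

text \<open>
  Zeros of \<open>\<zeta>\<close> filling a segment of the critical line would accumulate inside the domain, and \<open>\<zeta>\<close> would vanish at
  \<open>2\<close> as well.
\<close>

lemma Zsq_not_locally_zero:
  assumes "a < b"
  obtains t where "t \<in> {a<..<b}" "Zsq t > 0"
proof (rule ccontr)
  assume "\<not> thesis"
  with that Zsq_nonneg have zero: "Zsq t = 0" if "t \<in> {a<..<b}" for t
    using that by (metis order_less_le)
  let ?S = "{s. Re s > 0} - {1::complex}"
  let ?U = "Complex (1/2) ` {a<..<b}"
  obtain c where c: "a < c" "c < b" using dense[OF assms] by blast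
  have "zeta 2 = 0"
  proof (rule analytic_continuation[OF zeta_holomorphic, of ?U "Complex (1/2) c"])
    show "open ?S" by (intro open_delete open_halfspace_Re_gt)
    show "connected ?S"
      by (intro connected_open_delete open_halfspace_Re_gt connected_halfspace_Re_gt) simp
    show "?U \<subseteq> ?S" "Complex (1/2) c \<in> ?S" "2 \<in> ?S" using c by (auto simp: complex_eq_iff)
    show "zeta z = 0" if "z \<in> ?U" for z using that zero by (auto simp: Zsq_def)
    show "Complex (1/2) c islimpt ?U"
      unfolding islimpt_approachable
    proof (intro allI impI)
      fix e :: real assume e: "e > 0"
      define h where "h = min (e / 2) ((b - c) / 2)"
      have h: "0 < h" "h < e" "c + h < b" "a < c + h"
        using e c by (auto simp: h_def min_def field_simps)
      have "dist (Complex (1/2) (c + h)) (Complex (1/2) c) = h"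
        using h by (simp add: dist_norm complex_diff cmod_def)
      then show "\<exists>x'\<in>?U. x' \<noteq> Complex (1/2) c \<and> dist x' (Complex (1/2) c) < e"
        using h by (intro bexI[of _ "Complex (1/2) (c + h)"]) auto
    qed
  qed
  with zeta_2_nonzero show False by simp
qed

section \<open>A mean value theorem for iterates\<close>

text \<open>
  This is the mean value theorem for \<open>H \<circ> p \<circ> \<dots> \<circ> p\<close> on \<open>[a\<^sub>k, b\<^sub>k]\<close>, with the orbit of the intermediate point
  made explicit. Each induction step moves the innermost \<open>p\<close> into \<open>H\<close> and shifts the intervals by one.
\<close>

lemma iterated_mean_value:
  fixes a b :: "nat \<Rightarrow> real" and p p' H h :: "real \<Rightarrow> real"
  assumes "\<And>r. r \<le> k \<Longrightarrow> a r < b r"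
    and "\<And>r. r < k \<Longrightarrow> p (a (Suc r)) = a r"
    and "\<And>r. r < k \<Longrightarrow> p (b (Suc r)) = b r"
    and "\<And>r t. r < k \<Longrightarrow> t \<in> {a (Suc r)<..<b (Suc r)} \<Longrightarrow> p t \<in> {a r<..<b r}"
    and "\<And>r t. r < k \<Longrightarrow> t \<in> {a (Suc r)..b (Suc r)} \<Longrightarrow> (p has_real_derivative p' t) (at t)"
    and "continuous_on {a 0..b 0} H"
    and "\<And>t. t \<in> {a 0<..<b 0} \<Longrightarrow> (H has_real_derivative h t) (at t)"
  shows "\<exists>x. (\<forall>r\<le>k. x r \<in> {a r<..<b r}) \<and>
           H (b 0) - H (a 0) = (b k - a k) * h (x 0) * (\<Prod>r=1..k. p' (x r))"
  using assms
proof (induction k arbitrary: a b H h)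
  case 0
  have "\<exists>l z. a 0 < z \<and> z < b 0 \<and> (H has_real_derivative l) (at z) \<and>
      H (b 0) - H (a 0) = (b 0 - a 0) * l"
  proof (rule MVT)
    show "H differentiable (at z)" if "a 0 < z" "z < b 0" for z
      using 0(7)[of z] that by (auto simp: real_differentiable_def)
  qed (use 0 in auto)
  then obtain l z where z: "a 0 < z" "z < b 0" "(H has_real_derivative l) (at z)"
    "H (b 0) - H (a 0) = (b 0 - a 0) * l" by blast
  moreover have "l = h z" using z 0(7)[of z] by (auto intro: DERIV_unique)
  ultimately have "a 0 < z" "z < b 0" "H (b 0) - H (a 0) = (b 0 - a 0) * h z" by auto
  then show ?case by (intro exI[of _ "\<lambda>_. z"]) auto
next
  case (Suc k)
  have "\<exists>y. (\<forall>r\<le>k. y r \<in> {a (Suc r)<..<b (Suc r)}) \<and>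
      (H \<circ> p) (b (Suc 0)) - (H \<circ> p) (a (Suc 0))
        = (b (Suc k) - a (Suc k)) * (h (p (y 0)) * p' (y 0)) * (\<Prod>r=1..k. p' (y r))"
  proof (rule Suc.IH)
    have "p ` {a (Suc 0)..b (Suc 0)} \<subseteq> {a 0..b 0}"
    proof
      fix u assume "u \<in> p ` {a (Suc 0)..b (Suc 0)}"
      then obtain t where t: "t \<in> {a (Suc 0)..b (Suc 0)}" "u = p t" by blast
      then consider "t = a (Suc 0)" | "t = b (Suc 0)" | "t \<in> {a (Suc 0)<..<b (Suc 0)}" by force
      then show "u \<in> {a 0..b 0}"
        using Suc.prems(1)[of 0] Suc.prems(2)[of 0] Suc.prems(3)[of 0] Suc.prems(4)[of 0 t] t(2)
        by cases auto
    qed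
    moreover have "continuous_on {a (Suc 0)..b (Suc 0)} p"
      using Suc.prems(5)[of 0] by (blast intro: continuous_at_imp_continuous_on DERIV_isCont)
    ultimately show "continuous_on {a (Suc 0)..b (Suc 0)} (H \<circ> p)"
      using continuous_on_compose2[OF Suc.prems(6)] by (simp add: comp_def)
    show "((H \<circ> p) has_real_derivative h (p t) * p' t) (at t)"
      if "t \<in> {a (Suc 0)<..<b (Suc 0)}" for t
      using that Suc.prems(4)[of 0 t] Suc.prems(5)[of 0 t] Suc.prems(7)[of "p t"]
      by (intro DERIV_chain) auto
    show "(p has_real_derivative p' t) (at t)"
      if "r < k" "t \<in> {a (Suc (Suc r))..b (Suc (Suc r))}" for r t
      using that by (intro Suc.prems(5)[of "Suc r"]) auto
  qed (use Suc.prems(1-4) in auto)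
  then obtain y where y: "\<And>r. r \<le> k \<Longrightarrow> y r \<in> {a (Suc r)<..<b (Suc r)}"
    "H (b 0) - H (a 0)
        = (b (Suc k) - a (Suc k)) * (h (p (y 0)) * p' (y 0)) * (\<Prod>r=1..k. p' (y r))"
    using Suc.prems(2)[of 0] Suc.prems(3)[of 0] by auto
  \<comment> \<open>The orbit found for \<open>H \<circ> p\<close> lives one level up; its last image under \<open>p\<close> is prepended.\<close>
  define x where "x = (\<lambda>r. case r of 0 \<Rightarrow> p (y 0) | Suc r \<Rightarrow> y r)"
  have "(\<Prod>r=1..Suc k. p' (x r)) = p' (y 0) * (\<Prod>r=1..k. p' (y r))"
  proof -
    have "(\<Prod>r=1..Suc k. p' (x r)) = (\<Prod>r=0..k. p' (x (Suc r)))"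
      unfolding One_nat_def by (rule prod.shift_bounds_cl_Suc_ivl)
    then show ?thesis by (simp add: x_def prod.atLeast_Suc_atMost)
  qed
  then have "H (b 0) - H (a 0)
      = (b (Suc k) - a (Suc k)) * h (x 0) * (\<Prod>r=1..Suc k. p' (x r))"
    using y(2) by (simp add: x_def)
  moreover have "x r \<in> {a r<..<b r}" if "r \<le> Suc k" for r
    using that y(1)[of 0] y(1)[of "r - 1"] Suc.prems(4)[of 0 "y 0"]
    by (cases r) (auto simp: x_def)
  ultimately show ?case by blast
qed

section \<open>The two sides of the ladder equation\<close>

definition second_moment :: "real \<Rightarrow> real" where
  "second_moment T = integral {0..T} Zsq"

definition damped_integral :: "real \<Rightarrow> real \<Rightarrow> real" where
  "damped_integral x b = integral {0..b} (\<lambda>t. Zsq t * exp (- (2 * t / x)))"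

lemma ladder_equation_iff: "ladder_equation \<mu> T x \<longleftrightarrow> damped_integral x (\<mu> x) = second_moment T"
  by (simp add: ladder_equation_def damped_integral_def second_moment_def)

lemma integrable_Zsq_mult:
  assumes "continuous_on {a..b} g"
  shows "(\<lambda>t. Zsq t * g t) integrable_on {a..b}"
  by (intro integrable_continuous_real continuous_intros continuous_on_Zsq assms)

lemma integral_Zsq_mult_pos:
  assumes "a < b" "continuous_on {a..b} g" "\<And>t. t \<in> {a..b} \<Longrightarrow> 0 \<le> g t"
    "\<And>t. t \<in> {a<..<b} \<Longrightarrow> 0 < g t"
  shows "0 < integral {a..b} (\<lambda>t. Zsq t * g t)"
proof -
  obtain t where t: "t \<in> {a<..<b}" "Zsq t > 0" using Zsq_not_locally_zero[OF \<open>a < b\<close>] .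
  have "integral {a..b} (\<lambda>t. Zsq t * g t) \<noteq> 0"
  proof
    assume "integral {a..b} (\<lambda>t. Zsq t * g t) = 0"
    then have "\<forall>t\<in>{a..b}. Zsq t * g t = 0"
      using assms Zsq_nonneg
      by (subst (asm) integral_eq_0_iff) (auto intro!: continuous_intros continuous_on_Zsq)
    with t assms(4)[OF t(1)] show False by (auto dest!: bspec[of _ _ t])
  qed
  moreover have "0 \<le> integral {a..b} (\<lambda>t. Zsq t * g t)"
    using assms Zsq_nonneg by (intro integral_nonneg integrable_Zsq_mult) auto
  ultimately show ?thesis by simp
qed

lemma second_moment_0 [simp]: "second_moment 0 = 0" by (simp add: second_moment_def)

lemma second_moment_strict_mono:
  assumes "0 \<le> a" "a < b"
  shows "second_moment a < second_moment b"
proof -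
  have "integral {0..a} Zsq + integral {a..b} Zsq = integral {0..b} Zsq"
    using assms by (intro Henstock_Kurzweil_Integration.integral_combine integrable_continuous_real continuous_on_Zsq) auto
  moreover have "0 < integral {a..b} (\<lambda>t. Zsq t * 1)"
    using assms by (intro integral_Zsq_mult_pos) auto
  ultimately show ?thesis by (simp add: second_moment_def)
qed

lemma second_moment_has_derivative:
  assumes "0 < T"
  shows "(second_moment has_real_derivative Zsq T) (at T)"
proof -
  have "(second_moment has_real_derivative Zsq T) (at T within {0..T+1})"
    unfolding second_moment_def using assms
    by (intro integral_has_real_derivative continuous_on_Zsq) auto
  then show ?thesis using assms by (simp add: at_within_Icc_at)
qed

lemma continuous_on_second_moment: "continuous_on {0..T} second_moment"
  unfolding second_moment_def
  by (intro indefinite_integral_continuous_1 integrable_continuous_real continuous_on_Zsq)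

lemma damped_integral_nonpos [simp]: "b \<le> 0 \<Longrightarrow> damped_integral x b = 0"
  by (cases "b = 0") (simp_all add: damped_integral_def)

lemma damped_integral_pos: "0 < x \<Longrightarrow> 0 < b \<Longrightarrow> 0 < damped_integral x b"
  unfolding damped_integral_def by (auto intro!: integral_Zsq_mult_pos continuous_intros)

lemma damped_integral_le_second_moment:
  assumes "0 < x" shows "damped_integral x b \<le> second_moment b"
  unfolding damped_integral_def second_moment_def
proof (rule integral_le)
  show "Zsq integrable_on {0..b}" by (intro integrable_continuous_real continuous_on_Zsq)
  show "(\<lambda>t. Zsq t * exp (- (2 * t / x))) integrable_on {0..b}"
    using assms by (intro integrable_Zsq_mult continuous_intros) auto
  show "Zsq t * exp (- (2 * t / x)) \<le> Zsq t" if "t \<in> {0..b}" for t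
    using that assms Zsq_nonneg[of t] by (intro mult_left_le) auto
qed

lemma damped_integral_ge_second_moment:
  assumes "0 < x" "0 \<le> c" "c \<le> b"
  shows "exp (- (2 * c / x)) * second_moment c \<le> damped_integral x b"
proof -
  have "exp (- (2 * c / x)) * second_moment c = integral {0..c} (\<lambda>t. Zsq t * exp (- (2 * c / x)))"
    by (simp add: second_moment_def mult.commute)
  also have "\<dots> \<le> integral {0..c} (\<lambda>t. Zsq t * exp (- (2 * t / x)))"
    using assms Zsq_nonneg
    by (intro integral_le integrable_Zsq_mult continuous_intros mult_left_mono)
      (auto simp: divide_right_mono)
  also have "\<dots> \<le> damped_integral x b"
    unfolding damped_integral_def using assms Zsq_nonneg
    by (intro integral_subset_le integrable_Zsq_mult continuous_intros) auto
  finally show ?thesis .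
qed

lemma damped_integral_has_derivative_fst:
  assumes "0 < x"
  shows "((\<lambda>x. damped_integral x b) has_real_derivative
           integral {0..b} (\<lambda>t. Zsq t * (exp (- (2 * t / x)) * (2 * t / x\<^sup>2)))) (at x within {0<..})"
  unfolding damped_integral_def cbox_interval[symmetric]
proof (rule leibniz_rule_field_derivative)
  fix u t :: real assume "u \<in> {0<..}"
  then show "((\<lambda>x. Zsq t * exp (- (2 * t / x))) has_real_derivative
      Zsq t * (exp (- (2 * t / u)) * (2 * t / u\<^sup>2))) (at u within {0<..})"
    by (auto intro!: derivative_eq_intros simp: power2_eq_square)
next
  show "(\<lambda>t. Zsq t * exp (- (2 * t / u))) integrable_on cbox 0 b" if "u \<in> {0<..}" for u
    using that unfolding cbox_interval by (intro integrable_Zsq_mult continuous_intros) auto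
  show "continuous_on ({0<..} \<times> cbox 0 b)
      (\<lambda>(u, t). Zsq t * (exp (- (2 * t / u)) * (2 * t / u\<^sup>2)))"
    unfolding split_beta
    by (intro continuous_intros continuous_on_compose2[OF continuous_on_Zsq[of UNIV]]) auto
qed (use assms in auto)

lemma damped_integral_has_derivative_snd:
  assumes "0 < x" "0 < b"
  shows "(damped_integral x has_real_derivative Zsq b * exp (- (2 * b / x))) (at b)"
proof -
  have "(damped_integral x has_real_derivative Zsq b * exp (- (2 * b / x))) (at b within {0..b+1})"
    unfolding damped_integral_def using assms
    by (intro integral_has_real_derivative continuous_intros continuous_on_Zsq) auto
  then show ?thesis using assms by (simp add: at_within_Icc_at)
qed

text \<open>
  The variable enters through the damping factor and through the upper limit, and the two partial derivatives add up.
  The one in the upper limit is jointly continuous, which makes the partial derivatives a total derivative.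
\<close>

lemma damped_integral_compose_has_derivative:
  assumes "0 < x" "0 < \<mu> x" and \<mu>': "(\<mu> has_real_derivative m) (at x)"
  shows "((\<lambda>x. damped_integral x (\<mu> x)) has_real_derivative
     integral {0..\<mu> x} (\<lambda>t. Zsq t * (exp (- (2 * t / x)) * (2 * t / x\<^sup>2)))
     + Zsq (\<mu> x) * exp (- (2 * \<mu> x / x)) * m) (at x)"
proof -
  let ?X = "{0<..} :: real set"
  let ?A = "integral {0..\<mu> x} (\<lambda>t. Zsq t * (exp (- (2 * t / x)) * (2 * t / x\<^sup>2)))"
  let ?B = "\<lambda>x b. Zsq b * exp (- (2 * b / x))"
  have "((\<lambda>(x, b). damped_integral x b) has_derivative
      (\<lambda>(tx, tb). ?A * tx + blinfun_mult_right (?B x (\<mu> x)) tb)) (at (x, \<mu> x) within ?X \<times> ?X)"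
  proof (rule has_derivative_partialsI)
    show "((\<lambda>u. damped_integral u (\<mu> x)) has_derivative (*) ?A) (at x within ?X)"
      using damped_integral_has_derivative_fst[OF \<open>0 < x\<close>, of "\<mu> x"] by (simp only: has_field_derivative_def)
    show "(damped_integral u has_derivative blinfun_apply (blinfun_mult_right (?B u b))) (at b within ?X)"
      if "u \<in> ?X" "b \<in> ?X" for u b
      using damped_integral_has_derivative_snd[of u b] that
      by (simp add: has_field_derivative_def has_derivative_at_withinI)
    have "continuous_on (?X \<times> ?X) (\<lambda>(u, b). blinfun_mult_right (?B u b))"
      unfolding split_beta
      by (intro bounded_linear.continuous_on[OF bounded_linear_blinfun_mult_right] continuous_intros
          continuous_on_compose2[OF continuous_on_Zsq[of UNIV]]) auto
    then show "continuous (at (x, \<mu> x) within ?X \<times> ?X) (\<lambda>(u, b). blinfun_mult_right (?B u b))"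
      using assms by (simp add: continuous_on_eq_continuous_within)
  qed (use assms in auto)
  then have "((\<lambda>(x, b). damped_integral x b) has_derivative (\<lambda>(tx, tb). ?A * tx + ?B x (\<mu> x) * tb)) (at (x, \<mu> x))"
    using assms by (subst (asm) at_within_open) (auto simp: open_Times)
  moreover have "((\<lambda>x. (x, \<mu> x)) has_derivative (\<lambda>h. (h, m * h))) (at x)"
    using \<mu>' by (intro has_derivative_Pair) (auto simp: has_field_derivative_def)
  ultimately have "((\<lambda>x. case (x, \<mu> x) of (x, b) \<Rightarrow> damped_integral x b) has_derivative
      (\<lambda>h. case (h, m * h) of (tx, tb) \<Rightarrow> ?A * tx + ?B x (\<mu> x) * tb)) (at x)"
    by (rule has_derivative_compose[rotated])
  then show ?thesis
    by (simp add: has_derivative_imp_has_field_derivative algebra_simps)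
qed

section \<open>Jacob's ladder as a bijection of half-lines\<close>

context
  fixes y0 :: real and \<mu> :: "real \<Rightarrow> real"
  assumes mu: "admissible_mu y0 \<mu>"
begin

lemma y0_pos: "0 < y0"
  and mu_mono: "y0 < x \<Longrightarrow> x \<le> y \<Longrightarrow> \<mu> x \<le> \<mu> y"
  and mu_ge: "y0 < y \<Longrightarrow> 7 * y * ln y \<le> \<mu> y"
  using mu by (auto simp: admissible_mu_def mono_on_def)

lemma mu_has_derivative:
  assumes "y0 < x"
  shows "(\<mu> has_real_derivative deriv \<mu> x) (at x)" "0 \<le> deriv \<mu> x"
proof -
  have "(deriv ^^ 0) \<mu> differentiable_on {y0<..}" using mu unfolding admissible_mu_def by blast
  then have "\<mu> differentiable (at x)"
    using assms by (auto simp: differentiable_on_eq_differentiable_at)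
  then show D: "(\<mu> has_real_derivative deriv \<mu> x) (at x)"
    by (simp add: DERIV_deriv_iff_real_differentiable)
  show "0 \<le> deriv \<mu> x"
  proof (rule ccontr)
    assume "\<not> 0 \<le> deriv \<mu> x"
    then obtain d where d: "d > 0" "\<forall>h>0. h < d \<longrightarrow> \<mu> (x + h) < \<mu> x"
      using DERIV_neg_dec_right[OF D] by auto
    then have "\<mu> (x + d / 2) < \<mu> x" by simp
    with mu_mono[of x "x + d / 2"] assms d(1) show False by simp
  qed
qed

text \<open>
  Where \<open>\<mu> x \<le> 0\<close> the left-hand side of the equation vanishes, so that \<open>x\<close> solves it for no \<open>T > 0\<close>.
  The remaining \<open>x\<close> form a half-line, which turns out to be the range of \<open>\<phi>\<close>.
\<close>

definition ladder_range :: "real set" where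
  "ladder_range = {x. y0 < x \<and> 0 < \<mu> x}"

lemma ladder_rangeD: "x \<in> ladder_range \<Longrightarrow> y0 < x" "x \<in> ladder_range \<Longrightarrow> 0 < x" "x \<in> ladder_range \<Longrightarrow> 0 < \<mu> x"
  using y0_pos by (auto simp: ladder_range_def)

lemma ladder_range_up: "x \<in> ladder_range \<Longrightarrow> x \<le> y \<Longrightarrow> y \<in> ladder_range"
  using mu_mono[of x y] by (auto simp: ladder_range_def)

lemma open_ladder_range: "open ladder_range"
proof -
  have "continuous_on {y0<..} \<mu>"
    by (auto intro!: continuous_at_imp_continuous_on DERIV_isCont mu_has_derivative)
  then have "open ({y0<..} \<inter> \<mu> -` {0<..})"
    by (intro continuous_open_preimage) auto
  also have "{y0<..} \<inter> \<mu> -` {0<..} = ladder_range" by (auto simp: ladder_range_def)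
  finally show ?thesis .
qed

definition ladder_lhs :: "real \<Rightarrow> real" where
  "ladder_lhs x = damped_integral x (\<mu> x)"

lemma ladder_lhs_has_derivative:
  assumes "x \<in> ladder_range"
  obtains D where "(ladder_lhs has_real_derivative D) (at x)" "0 < D"
proof
  let ?D = "integral {0..\<mu> x} (\<lambda>t. Zsq t * (exp (- (2 * t / x)) * (2 * t / x\<^sup>2)))
     + Zsq (\<mu> x) * exp (- (2 * \<mu> x / x)) * deriv \<mu> x"
  show "(ladder_lhs has_real_derivative ?D) (at x)"
    unfolding ladder_lhs_def
    using ladder_rangeD[OF assms] by (intro damped_integral_compose_has_derivative mu_has_derivative)
  have "0 < integral {0..\<mu> x} (\<lambda>t. Zsq t * (exp (- (2 * t / x)) * (2 * t / x\<^sup>2)))"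
    using ladder_rangeD[OF assms] by (intro integral_Zsq_mult_pos continuous_intros) auto
  moreover have "0 \<le> Zsq (\<mu> x) * exp (- (2 * \<mu> x / x)) * deriv \<mu> x"
    using mu_has_derivative(2) ladder_rangeD[OF assms] Zsq_nonneg by (intro mult_nonneg_nonneg) auto
  ultimately show "0 < ?D" by simp
qed

lemma isCont_ladder_lhs: "x \<in> ladder_range \<Longrightarrow> isCont ladder_lhs x"
  by (elim ladder_lhs_has_derivative) (rule DERIV_isCont)

lemma ladder_lhs_strict_mono:
  assumes "x \<in> ladder_range" "x < y"
  shows "ladder_lhs x < ladder_lhs y"
  using \<open>x < y\<close>
proof (rule DERIV_pos_imp_increasing)
  fix z assume "x \<le> z" "z \<le> y"
  then have "z \<in> ladder_range" using ladder_range_up[OF assms(1)] by blast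
  then show "\<exists>D. (ladder_lhs has_real_derivative D) (at z) \<and> 0 < D"
    by (elim ladder_lhs_has_derivative) blast
qed

lemma ladder_lhs_less_iff:
  "x \<in> ladder_range \<Longrightarrow> y \<in> ladder_range \<Longrightarrow> ladder_lhs x < ladder_lhs y \<longleftrightarrow> x < y"
  by (metis ladder_lhs_strict_mono less_irrefl linorder_neqE_linordered_idom order_less_trans)

lemma ladder_lhs_pos: "x \<in> ladder_range \<Longrightarrow> 0 < ladder_lhs x"
  unfolding ladder_lhs_def by (intro damped_integral_pos ladder_rangeD)

lemma second_moment_pos: "0 < T \<Longrightarrow> 0 < second_moment T"
  using second_moment_strict_mono[of 0 T] by simp

lemma ladder_range_if_solution:
  assumes "0 < T" "y0 < x" "ladder_lhs x = second_moment T"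
  shows "x \<in> ladder_range"
proof -
  have "0 < ladder_lhs x" using assms second_moment_pos by simp
  then have "0 < \<mu> x" by (cases "\<mu> x \<le> 0") (auto simp: ladder_lhs_def)
  with assms show ?thesis by (simp add: ladder_range_def)
qed

lemma phi_eqI:
  assumes "0 < T" "x \<in> ladder_range" "ladder_lhs x = second_moment T"
  shows "T \<in> ladder_domain y0 \<mu>" "phi y0 \<mu> T = x"
proof -
  show "T \<in> ladder_domain y0 \<mu>"
    using assms ladder_rangeD by (auto simp: ladder_domain_def ladder_equation_iff ladder_lhs_def)
  show "phi y0 \<mu> T = x"
    unfolding phi_def ladder_equation_iff ladder_lhs_def[symmetric]
  proof (rule the_equality)
    fix y assume y: "y0 < y \<and> ladder_lhs y = second_moment T"
    then have "y \<in> ladder_range" using assms ladder_range_if_solution by blast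
    with y assms show "y = x"
      using ladder_lhs_strict_mono by (metis less_irrefl linorder_neqE_linordered_idom)
  qed (use assms ladder_rangeD in auto)
qed

lemma phi_solves:
  assumes "T \<in> ladder_domain y0 \<mu>"
  shows "phi y0 \<mu> T \<in> ladder_range" "ladder_lhs (phi y0 \<mu> T) = second_moment T" "0 < T"
proof -
  obtain x where x: "0 < T" "y0 < x" "ladder_lhs x = second_moment T"
    using assms by (auto simp: ladder_domain_def ladder_equation_iff ladder_lhs_def)
  have "x \<in> ladder_range" using x by (rule ladder_range_if_solution)
  with x phi_eqI(2)[of T x]
  show "phi y0 \<mu> T \<in> ladder_range" "ladder_lhs (phi y0 \<mu> T) = second_moment T" "0 < T" by auto
qed

lemma phi_strict_mono:
  assumes "S \<in> ladder_domain y0 \<mu>" "T \<in> ladder_domain y0 \<mu>" "S < T"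
  shows "phi y0 \<mu> S < phi y0 \<mu> T"
  using second_moment_strict_mono[of S T] phi_solves[OF assms(1)] phi_solves[OF assms(2)] assms(3)
    ladder_lhs_less_iff[of "phi y0 \<mu> S" "phi y0 \<mu> T"] by auto

text \<open>
  Removing the damping factor enlarges the integral, so \<open>\<mu> x\<close> is an upper bound for the \<open>T\<close> belonging to \<open>x\<close>.
\<close>

lemma phi_surj:
  assumes "x \<in> ladder_range"
  obtains T where "T \<in> ladder_domain y0 \<mu>" "phi y0 \<mu> T = x"
proof -
  have le: "ladder_lhs x \<le> second_moment (\<mu> x)"
    unfolding ladder_lhs_def using assms by (intro damped_integral_le_second_moment ladder_rangeD)
  have "\<exists>T\<ge>0. T \<le> \<mu> x \<and> second_moment T = ladder_lhs x"
    using le ladder_lhs_pos[OF assms] ladder_rangeD(3)[OF assms]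
    by (intro IVT') (auto intro: continuous_on_second_moment)
  then obtain T where T: "0 \<le> T" "second_moment T = ladder_lhs x" by blast
  with ladder_lhs_pos[OF assms] have "0 < T" by (cases "T = 0") auto
  with T assms show ?thesis using phi_eqI[of T x] that by auto
qed

text \<open>
  For large \<open>x\<close> the damping factor is close to \<open>1\<close> on \<open>[0, T + 1]\<close>, while \<open>\<mu> x \<ge> T + 1\<close>; the left-hand side then
  nearly reaches the integral up to \<open>T + 1\<close>, which is strictly larger than the one up to \<open>T\<close>.
\<close>

lemma eventually_ladder_lhs_greater:
  assumes "0 < T"
  shows "eventually (\<lambda>x. x \<in> ladder_range \<and> second_moment T < ladder_lhs x) at_top"
proof -
  have "((\<lambda>x::real. exp (- (2 * (T + 1) / x)) * second_moment (T + 1)) \<longlongrightarrow> exp (- 0) * second_moment (T + 1)) at_top"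
    by (intro tendsto_intros tendsto_divide_0[OF tendsto_const] filterlim_at_top_imp_at_infinity
        filterlim_ident)
  then have 1: "eventually (\<lambda>x. second_moment T < exp (- (2 * (T + 1) / x)) * second_moment (T + 1)) at_top"
    using second_moment_strict_mono[of T "T + 1"] assms by (intro order_tendstoD(1)) auto
  show ?thesis
    using 1 eventually_gt_at_top[of y0] eventually_ge_at_top[of "exp 1"] eventually_ge_at_top[of "T + 1"]
  proof eventually_elim
    case (elim x)
    have "1 \<le> ln x" using elim by (subst ln_ge_iff) (auto intro: less_le_trans[OF exp_gt_zero])
    then have "x * 1 \<le> (7 * x) * ln x" using elim assms by (intro mult_mono) auto
    then have mu: "T + 1 \<le> \<mu> x" using mu_ge[of x] elim by simp
    then have "exp (- (2 * (T + 1) / x)) * second_moment (T + 1) \<le> ladder_lhs x"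
      unfolding ladder_lhs_def using elim assms y0_pos by (intro damped_integral_ge_second_moment) auto
    with elim mu assms show ?case by (auto simp: ladder_range_def)
  qed
qed

lemma ladder_domainI:
  assumes "x \<in> ladder_range" "0 < T" "ladder_lhs x \<le> second_moment T"
  shows "T \<in> ladder_domain y0 \<mu>"
proof -
  obtain y where y: "y \<in> ladder_range" "second_moment T < ladder_lhs y" "x \<le> y"
    using eventually_happens[OF eventually_conj[OF eventually_ladder_lhs_greater[OF assms(2)]
        eventually_ge_at_top[of x]]] by auto
  have "\<exists>z\<ge>x. z \<le> y \<and> ladder_lhs z = second_moment T"
    using y assms ladder_range_up[OF assms(1)]
    by (intro IVT') (auto intro!: continuous_at_imp_continuous_on isCont_ladder_lhs)
  then show ?thesis using phi_eqI(1)[of T] ladder_range_up[OF assms(1)] assms(2) by blast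
qed

lemma ladder_domain_up:
  assumes "S \<in> ladder_domain y0 \<mu>" "S \<le> T"
  shows "T \<in> ladder_domain y0 \<mu>"
  using phi_solves[OF assms(1)] second_moment_strict_mono[of S T] assms(2)
  by (intro ladder_domainI[of "phi y0 \<mu> S"]) (auto simp: le_less)

lemma ladder_range_nonempty: "\<exists>x. x \<in> ladder_range"
  using eventually_happens[OF eventually_ladder_lhs_greater[of 1]] by auto

lemma ladder_domain_nonempty: "\<exists>T. T \<in> ladder_domain y0 \<mu>"
  using ladder_range_nonempty phi_surj by metis

text \<open>
  A point of the domain is not minimal in it, as its value under \<open>\<phi>\<close> is not minimal in the open range; and the
  domain is closed upwards.
\<close>

lemma open_ladder_domain: "open (ladder_domain y0 \<mu>)"
proof (rule openI)
  fix T assume T: "T \<in> ladder_domain y0 \<mu>"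
  obtain e where e: "e > 0" "ball (phi y0 \<mu> T) e \<subseteq> ladder_range"
    using open_ladder_range phi_solves(1)[OF T] openE by blast
  then have x: "phi y0 \<mu> T - e / 2 \<in> ladder_range" by (auto simp: dist_norm)
  then obtain S where S: "S \<in> ladder_domain y0 \<mu>" "phi y0 \<mu> S = phi y0 \<mu> T - e / 2"
    using phi_surj by blast
  have "S < T"
    using S e T phi_strict_mono[OF T S(1)] by (cases S T rule: linorder_cases) auto
  then have "ball T (T - S) \<subseteq> ladder_domain y0 \<mu>"
    using ladder_domain_up[OF S(1)] by (auto simp: dist_real_def)
  with \<open>S < T\<close> show "\<exists>e>0. ball T e \<subseteq> ladder_domain y0 \<mu>"
    by (intro exI[of _ "T - S"]) auto
qed

lemma phi_differentiable:
  assumes "T \<in> ladder_domain y0 \<mu>"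
  shows "phi y0 \<mu> differentiable (at T)"
proof -
  let ?x = "phi y0 \<mu> T" and ?g = "the_inv_into ladder_range ladder_lhs"
  have inj: "inj_on ladder_lhs ladder_range"
    by (rule inj_onI) (metis ladder_lhs_strict_mono less_irrefl linorder_neqE_linordered_idom)
  have x: "?x \<in> ladder_range" "ladder_lhs ?x = second_moment T" using phi_solves[OF assms] by auto
  obtain D where D: "(ladder_lhs has_real_derivative D) (at ?x)" "0 < D"
    using ladder_lhs_has_derivative[OF x(1)] .
  \<comment> \<open>On its domain, \<open>\<phi>\<close> is the composition of the inverse of the left-hand side with the second moment.\<close>
  have "(?g has_real_derivative inverse D) (at (ladder_lhs ?x))"
    using D x open_ladder_range isCont_ladder_lhs the_inv_into_f_f[OF inj]
    by (intro has_field_derivative_inverse_strong[where S = ladder_range])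
      (auto intro: continuous_at_imp_continuous_on)
  then have "((\<lambda>t. ?g (second_moment t)) has_real_derivative inverse D * Zsq T) (at T)"
    unfolding x(2) by (rule DERIV_chain2[OF _ second_moment_has_derivative]) (use phi_solves[OF assms] in auto)
  then have "(phi y0 \<mu> has_real_derivative inverse D * Zsq T) (at T)"
  proof (rule has_field_derivative_transform_within_open[OF _ open_ladder_domain assms])
    fix t assume "t \<in> ladder_domain y0 \<mu>"
    then show "?g (second_moment t) = phi y0 \<mu> t"
      using phi_solves[of t] the_inv_into_f_f[OF inj] by metis
  qed
  then show ?thesis by (auto simp: real_differentiable_def)
qed

lemma phi1_has_derivative:
  assumes "T \<in> ladder_domain y0 \<mu>"
  shows "(phi1 y0 \<mu> has_real_derivative Ztsq y0 \<mu> T) (at T)"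
proof -
  have "phi1 y0 \<mu> differentiable (at T)"
    unfolding phi1_def using phi_differentiable[OF assms] by (intro differentiable_divide) auto
  then show ?thesis by (simp add: Ztsq_def DERIV_deriv_iff_real_differentiable)
qed

lemma phi1_less_iff:
  assumes "S \<in> ladder_domain y0 \<mu>" "T \<in> ladder_domain y0 \<mu>"
  shows "phi1 y0 \<mu> S < phi1 y0 \<mu> T \<longleftrightarrow> S < T"
  using phi_strict_mono[OF assms] phi_strict_mono[OF assms(2,1)]
  by (cases S T rule: linorder_cases) (auto simp: phi1_def)

lemma inj_on_phi1: "inj_on (phi1 y0 \<mu>) (ladder_domain y0 \<mu>)"
  by (rule inj_onI) (metis phi1_less_iff less_irrefl linorder_neqE_linordered_idom)

lemma phi1_image: "phi1 y0 \<mu> ` ladder_domain y0 \<mu> = {x. 2 * x \<in> ladder_range}"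
proof (intro equalityI subsetI)
  fix x assume "x \<in> {x. 2 * x \<in> ladder_range}"
  then obtain T where "T \<in> ladder_domain y0 \<mu>" "phi y0 \<mu> T = 2 * x" using phi_surj by auto
  then show "x \<in> phi1 y0 \<mu> ` ladder_domain y0 \<mu>"
    by (intro image_eqI[of _ _ T]) (auto simp: phi1_def)
qed (auto simp: phi1_def phi_solves)

section \<open>Reverse iterates\<close>

lemma rev_iter_Suc:
  assumes "2 * rev_iter y0 \<mu> r x \<in> ladder_range"
  shows "rev_iter y0 \<mu> (Suc r) x \<in> ladder_domain y0 \<mu>"
    and "phi1 y0 \<mu> (rev_iter y0 \<mu> (Suc r) x) = rev_iter y0 \<mu> r x"
  using assms phi1_image the_inv_into_into[OF inj_on_phi1] f_the_inv_into_f[OF inj_on_phi1]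
  by auto

text \<open>
  Since \<open>\<phi>\<^sub>1\<close> is increasing and defined at every large \<open>T\<close>, a preimage of a point above \<open>\<phi>\<^sub>1 T\<close>
  lies above \<open>T\<close>.
\<close>

lemma rev_iter_at_top: "filterlim (rev_iter y0 \<mu> r) at_top at_top"
proof (induction r)
  case 0
  show ?case by (simp add: filterlim_ident)
next
  case (Suc r)
  show ?case
    unfolding filterlim_at_top
  proof
    fix M
    obtain T0 where T0: "T0 \<in> ladder_domain y0 \<mu>" using ladder_domain_nonempty by blast
    define T where "T = max T0 M"
    have T: "T \<in> ladder_domain y0 \<mu>" "M \<le> T" using ladder_domain_up[OF T0] by (auto simp: T_def)
    have "2 * phi1 y0 \<mu> T \<in> ladder_range" using phi_solves(1)[OF T(1)] by (simp add: phi1_def)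
    have "eventually (\<lambda>x. phi1 y0 \<mu> T \<le> rev_iter y0 \<mu> r x) at_top"
      using Suc.IH unfolding filterlim_at_top by blast
    then show "eventually (\<lambda>x. M \<le> rev_iter y0 \<mu> (Suc r) x) at_top"
    proof eventually_elim
      case (elim x)
      then have a: "2 * rev_iter y0 \<mu> r x \<in> ladder_range"
        using ladder_range_up[OF \<open>2 * phi1 y0 \<mu> T \<in> ladder_range\<close>] by simp
      have "\<not> rev_iter y0 \<mu> (Suc r) x < T"
        using phi1_less_iff[OF rev_iter_Suc(1)[OF a] T(1)] rev_iter_Suc(2)[OF a] elim by simp
      with T(2) show ?case by simp
    qed
  qed
qed

text \<open>
  Exactly then do the first \<open>k\<close> reverse iterates arise as preimages under \<open>\<phi>\<^sub>1\<close>, whose range consists of the halves of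
  the points of \<open>ladder_range\<close>.
\<close>

definition reversible :: "nat \<Rightarrow> real \<Rightarrow> bool" where
  "reversible k x \<longleftrightarrow> (\<forall>r<k. 2 * rev_iter y0 \<mu> r x \<in> ladder_range)"

lemma eventually_reversible: "eventually (reversible k) at_top"
proof -
  obtain x0 where x0: "x0 \<in> ladder_range" using ladder_range_nonempty by blast
  have "eventually (\<lambda>x. \<forall>r\<in>{..<k}. x0 / 2 \<le> rev_iter y0 \<mu> r x) at_top"
    using rev_iter_at_top unfolding filterlim_at_top by (intro eventually_ball_finite) blast+
  then show ?thesis
  proof eventually_elim
    case (elim x)
    then have "x0 \<le> 2 * rev_iter y0 \<mu> r x" if "r < k" for r
      using bspec[OF elim lessThan_iff[THEN iffD2, OF that]] by simp
    then show ?case using ladder_range_up[OF x0] by (auto simp: reversible_def)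
  qed
qed

lemma reversible_mono: "reversible k x \<Longrightarrow> j \<le> k \<Longrightarrow> reversible j x"
  by (auto simp: reversible_def)

lemma rev_iter_strict_mono:
  assumes "reversible k x" "x < y" "r \<le> k"
  shows "rev_iter y0 \<mu> r x < rev_iter y0 \<mu> r y"
  using \<open>r \<le> k\<close>
proof (induction r)
  case 0
  show ?case using assms by simp
next
  case (Suc r)
  then have less: "rev_iter y0 \<mu> r x < rev_iter y0 \<mu> r y" and
    a: "2 * rev_iter y0 \<mu> r x \<in> ladder_range" using assms(1) by (auto simp: reversible_def)
  then have b: "2 * rev_iter y0 \<mu> r y \<in> ladder_range" using ladder_range_up[OF a] by simp
  show ?case
    using phi1_less_iff[OF rev_iter_Suc(1)[OF a] rev_iter_Suc(1)[OF b]] less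
    unfolding rev_iter_Suc(2)[OF a] rev_iter_Suc(2)[OF b] by blast
qed

lemma reversible_up:
  assumes "reversible k x" "x \<le> y"
  shows "reversible k y"
  using assms rev_iter_strict_mono[OF assms(1)] ladder_range_up unfolding reversible_def
  by (metis le_less less_imp_le mult_left_mono zero_le_numeral)

section \<open>Factorization points\<close>

lemma iterated_ladder_mean_value:
  assumes "0 < U" "reversible k T" "continuous_on {T..T+U} f"
  obtains \<alpha> where "\<And>r. r \<le> k \<Longrightarrow> \<alpha> r \<in> {rev_iter y0 \<mu> r T<..<rev_iter y0 \<mu> r (T+U)}"
    "integral {T..T+U} f = (rev_iter y0 \<mu> k (T+U) - rev_iter y0 \<mu> k T) * f (\<alpha> 0)
       * (\<Prod>r=1..k. Ztsq y0 \<mu> (\<alpha> r))"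
proof -
  let ?a = "\<lambda>r. rev_iter y0 \<mu> r T" and ?b = "\<lambda>r. rev_iter y0 \<mu> r (T+U)"
  have rev: "reversible k (T+U)" using assms by (intro reversible_up[OF assms(2)]) auto
  have act: "2 * ?a r \<in> ladder_range" "2 * ?b r \<in> ladder_range" if "r < k" for r
    using that assms(2) rev by (auto simp: reversible_def)
  have dom: "t \<in> ladder_domain y0 \<mu>" if "r < k" "?a (Suc r) \<le> t" for r t
    using ladder_domain_up[OF rev_iter_Suc(1)[OF act(1)[OF that(1)]] that(2)] .
  let ?H = "\<lambda>t. integral {T..t} f"
  have "\<exists>x. (\<forall>r\<le>k. x r \<in> {?a r<..<?b r}) \<and>
      ?H (?b 0) - ?H (?a 0) = (?b k - ?a k) * f (x 0) * (\<Prod>r=1..k. Ztsq y0 \<mu> (x r))"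
  proof (rule iterated_mean_value[where p = "phi1 y0 \<mu>"])
    show "?a r < ?b r" if "r \<le> k" for r
      using rev_iter_strict_mono[OF assms(2) _ that] assms(1) by simp
    show "phi1 y0 \<mu> (?a (Suc r)) = ?a r" "phi1 y0 \<mu> (?b (Suc r)) = ?b r" if "r < k" for r
      using rev_iter_Suc(2) act[OF that] by auto
    show "phi1 y0 \<mu> t \<in> {?a r<..<?b r}" if "r < k" "t \<in> {?a (Suc r)<..<?b (Suc r)}" for r t
    proof -
      have "t \<in> ladder_domain y0 \<mu>" using dom[OF that(1)] that(2) by auto
      then show ?thesis
        using that(2) phi1_less_iff[OF rev_iter_Suc(1)[OF act(1)[OF that(1)]], of t]
          phi1_less_iff[OF _ rev_iter_Suc(1)[OF act(2)[OF that(1)]], of t]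
        unfolding rev_iter_Suc(2)[OF act(1)[OF that(1)]] rev_iter_Suc(2)[OF act(2)[OF that(1)]]
        by auto
    qed
    show "(phi1 y0 \<mu> has_real_derivative Ztsq y0 \<mu> t) (at t)"
      if "r < k" "t \<in> {?a (Suc r)..?b (Suc r)}" for r t
      using dom[OF that(1)] that(2) by (intro phi1_has_derivative) auto
    show "continuous_on {?a 0..?b 0} ?H"
      using assms(3) by (auto intro!: indefinite_integral_continuous_1 integrable_continuous_real)
    show "(?H has_real_derivative f t) (at t)" if "t \<in> {?a 0<..<?b 0}" for t
      using integral_has_real_derivative[OF assms(3), of t] that by (simp add: at_within_Icc_at)
  qed
  then show ?thesis using that by auto
qed

text \<open>
  The length of the last interval is the same for all \<open>f\<close>. It cancels between the mean value formulas for \<open>f\<close> and for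
  the constant \<open>1\<close>, and the latter formula supplies the \<open>\<beta>\<close>, which are thus chosen before \<open>f\<close>.
\<close>

lemma common_beta_factorization:
  assumes "0 < U" "reversible k T"
  shows "\<exists>\<beta>. \<forall>f. continuous_on {T..T+U} f \<and> (\<forall>t\<in>{T..T+U}. 0 \<le> f t) \<and> (\<exists>t\<in>{T..T+U}. f t \<noteq> 0)
    \<longrightarrow> (\<exists>\<alpha>. zeta_factorization_points y0 \<mu> U T k f \<alpha> \<beta>)"
proof -
  let ?d = "rev_iter y0 \<mu> k (T+U) - rev_iter y0 \<mu> k T"
  obtain \<beta> where \<beta>: "\<And>r. r \<le> k \<Longrightarrow> \<beta> r \<in> {rev_iter y0 \<mu> r T<..<rev_iter y0 \<mu> r (T+U)}"
    "integral {T..T+U} (\<lambda>_. 1) = ?d * 1 * (\<Prod>r=1..k. Ztsq y0 \<mu> (\<beta> r))"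
    using iterated_ladder_mean_value[OF assms, of "\<lambda>_. 1"] by auto
  then have B: "U = ?d * (\<Prod>r=1..k. Ztsq y0 \<mu> (\<beta> r))" using assms(1) by simp
  with assms(1) have "?d \<noteq> 0" and nz: "(\<Prod>r=1..k. Ztsq y0 \<mu> (\<beta> r)) \<noteq> 0"
    by (auto simp del: prod_zero_iff)
  show ?thesis
  proof (rule exI[of _ \<beta>], intro allI impI)
    fix f :: "real \<Rightarrow> real"
    assume "continuous_on {T..T+U} f \<and> (\<forall>t\<in>{T..T+U}. 0 \<le> f t) \<and> (\<exists>t\<in>{T..T+U}. f t \<noteq> 0)"
    then have f: "continuous_on {T..T+U} f" "\<And>t. t \<in> {T..T+U} \<Longrightarrow> 0 \<le> f t"
      "\<exists>t\<in>{T..T+U}. f t \<noteq> 0" by auto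
    obtain \<alpha> where \<alpha>: "\<And>r. r \<le> k \<Longrightarrow> \<alpha> r \<in> {rev_iter y0 \<mu> r T<..<rev_iter y0 \<mu> r (T+U)}"
      "integral {T..T+U} f = ?d * f (\<alpha> 0) * (\<Prod>r=1..k. Ztsq y0 \<mu> (\<alpha> r))"
      using iterated_ladder_mean_value[OF assms f(1)] by blast
    have "integral {T..T+U} f \<noteq> 0"
      using integral_eq_0_iff[OF f(1)] f assms(1) by auto
    then have f0: "f (\<alpha> 0) \<noteq> 0" using \<alpha>(2) by auto
    have "(\<Prod>r=1..k. Ztsq y0 \<mu> (\<alpha> r) / Ztsq y0 \<mu> (\<beta> r))
        = (\<Prod>r=1..k. Ztsq y0 \<mu> (\<alpha> r)) / (\<Prod>r=1..k. Ztsq y0 \<mu> (\<beta> r))"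
      by (rule prod_dividef)
    also have "\<dots> = 1 / f (\<alpha> 0) * (1 / (?d * (\<Prod>r=1..k. Ztsq y0 \<mu> (\<beta> r))) * integral {T..T+U} f)"
      using \<alpha>(2) \<open>?d \<noteq> 0\<close> nz f0 by (simp add: divide_simps)
    finally have "(\<Prod>r=1..k. Ztsq y0 \<mu> (\<alpha> r) / Ztsq y0 \<mu> (\<beta> r))
        = 1 / f (\<alpha> 0) * (1 / U * integral {T..T+U} f)" unfolding B[symmetric] .
    then have "zeta_factorization_points y0 \<mu> U T k f \<alpha> \<beta>"
      using f f0 \<alpha>(1) \<alpha>(1)[of 0] \<beta>(1) nz unfolding zeta_factorization_points_def
      by (simp add: prod_zero_iff)
    then show "\<exists>\<alpha>. zeta_factorization_points y0 \<mu> U T k f \<alpha> \<beta>" by blast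
  qed
qed

end

text \<open>
  In this form the formula is linear in \<open>f\<close>, and its right-hand side no longer depends on \<open>k\<close>. This is why
  factorizations with different \<open>k\<close> can be combined.
\<close>

lemma factorization_value:
  assumes "zeta_factorization_points y0 \<mu> U T k f \<alpha> \<beta>"
  shows "f (\<alpha> 0) * (\<Prod>r=1..k. Ztsq y0 \<mu> (\<alpha> r) / Ztsq y0 \<mu> (\<beta> r)) = 1 / U * integral {T..T+U} f"
  using assms unfolding zeta_factorization_points_def by simp

lemma factorization_points_bounds:
  assumes "zeta_factorization_points y0 \<mu> U T k f \<alpha> \<beta>"
  shows "\<alpha> 0 \<in> {T<..<T+U} \<and> (\<forall>r\<in>{1..k}.
      \<alpha> r \<in> {rev_iter y0 \<mu> r T<..<rev_iter y0 \<mu> r (T+U)} \<and>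
      \<beta> r \<in> {rev_iter y0 \<mu> r T<..<rev_iter y0 \<mu> r (T+U)})"
  using assms unfolding zeta_factorization_points_def by blast

lemma factorization_points_in_Delta_set:
  assumes "zeta_factorization_points y0 \<mu> U T k f \<alpha> \<beta>" "k \<le> K"
  shows "\<alpha> ` {0..k} \<subseteq> Delta_set y0 \<mu> U T K" "\<beta> ` {1..k} \<subseteq> Delta_set y0 \<mu> U T K"
proof -
  have "\<alpha> r \<in> {rev_iter y0 \<mu> r T..rev_iter y0 \<mu> r (T+U)}" if "r \<in> {0..k}" for r
    using factorization_points_bounds[OF assms(1)] that
    by (cases "r = 0") (auto simp: Ball_def less_imp_le)
  then show "\<alpha> ` {0..k} \<subseteq> Delta_set y0 \<mu> U T K"
    using assms(2) unfolding Delta_set_def by force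
  have "\<beta> r \<in> {rev_iter y0 \<mu> r T..rev_iter y0 \<mu> r (T+U)}" if "r \<in> {1..k}" for r
    using factorization_points_bounds[OF assms(1)] that by (auto simp: Ball_def less_imp_le)
  then show "\<beta> ` {1..k} \<subseteq> Delta_set y0 \<mu> U T K"
    using assms(2) unfolding Delta_set_def by force
qed

lemma Delta_set_mono: "k \<le> K \<Longrightarrow> Delta_set y0 \<mu> U T k \<subseteq> Delta_set y0 \<mu> U T K"
  unfolding Delta_set_def by (intro UN_mono) auto

lemma cos_double_shift_pi: "cos (2 * t) = cos (2 * (t - pi * real L))"
proof -
  have "2 * t = 2 * (t - pi * real L) + 2 * real L * pi" by (simp add: algebra_simps)
  then have "cos (2 * t) = cos (2 * (t - pi * real L) + 2 * real L * pi)" by (rule arg_cong)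
  also have "\<dots> = cos (2 * (t - pi * real L))"
    by (simp only: cos_add cos_2npi sin_2npi mult_1_right mult_zero_right diff_0_right)
  finally show ?thesis .
qed

theorem theorem1:
  fixes y0 :: real and \<mu> :: "real \<Rightarrow> real" and k0 :: nat
  assumes mu: "admissible_mu y0 \<mu>"
  shows "\<exists>L0::real. L0 > 0 \<and> (\<forall>L::nat. \<forall>U::real. real L \<ge> L0 \<longrightarrow> U \<in> {0<..<pi/4} \<longrightarrow>
    (\<exists>(\<alpha>1 :: nat \<Rightarrow> nat \<Rightarrow> real) (\<alpha>2 :: nat \<Rightarrow> nat \<Rightarrow> real) (\<alpha>3 :: nat \<Rightarrow> nat \<Rightarrow> real)
       (\<beta> :: nat \<Rightarrow> nat \<Rightarrow> real).
      (\<forall>k\<in>{1..k0}.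
         zeta_factorization_points y0 \<mu> U (pi * L) k (\<lambda>t. t * (sin t)\<^sup>2) (\<alpha>1 k) (\<beta> k) \<and>
         zeta_factorization_points y0 \<mu> U (pi * L) k (\<lambda>t. t * (cos t)\<^sup>2) (\<alpha>2 k) (\<beta> k) \<and>
         zeta_factorization_points y0 \<mu> U (pi * L) k (\<lambda>t. t * cos (2 * t)) (\<alpha>3 k) (\<beta> k)) \<and>
      (\<forall>k1\<in>{1..k0}. \<forall>k2\<in>{1..k0}. \<forall>k3\<in>{1..k0}.
         (\<alpha>2 k2 0 * (\<Prod>r=1..k2. Ztsq y0 \<mu> (\<alpha>2 k2 r) / Ztsq y0 \<mu> (\<beta> k2 r))) * (cos (\<alpha>2 k2 0))\<^sup>2
         - (\<alpha>1 k1 0 * (\<Prod>r=1..k1. Ztsq y0 \<mu> (\<alpha>1 k1 r) / Ztsq y0 \<mu> (\<beta> k1 r))) * (sin (\<alpha>1 k1 0))\<^sup>2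
         = (\<alpha>3 k3 0 * (\<Prod>r=1..k3. Ztsq y0 \<mu> (\<alpha>3 k3 r) / Ztsq y0 \<mu> (\<beta> k3 r))) * cos (2 * \<alpha>3 k3 0)) \<and>
      (\<forall>\<alpha>\<in>{\<alpha>1, \<alpha>2, \<alpha>3}. \<forall>k\<in>{1..k0}.
         \<alpha> k 0 \<in> {pi * L<..<pi * L + U} \<and>
         (\<forall>r\<in>{1..k}.
            \<alpha> k r \<in> {rev_iter y0 \<mu> r (pi * L)<..<rev_iter y0 \<mu> r (pi * L + U)} \<and>
            \<beta> k r \<in> {rev_iter y0 \<mu> r (pi * L)<..<rev_iter y0 \<mu> r (pi * L + U)})) \<and>
      (\<forall>k1\<in>{1..k0}. \<forall>k2\<in>{1..k0}. \<forall>k3\<in>{1..k0}.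
         \<alpha>1 k1 ` {0..k1} \<union> \<alpha>2 k2 ` {0..k2} \<union> \<alpha>3 k3 ` {0..k3} \<union>
           \<beta> k1 ` {1..k1} \<union> \<beta> k2 ` {1..k2} \<union> \<beta> k3 ` {1..k3}
           \<subseteq> Delta_set y0 \<mu> U (pi * L) (Max {k1, k2, k3}) \<and>
         Delta_set y0 \<mu> U (pi * L) (Max {k1, k2, k3}) \<subseteq> Delta_set y0 \<mu> U (pi * L) k0)))"
proof -
  obtain X where X: "\<And>x. X \<le> x \<Longrightarrow> reversible y0 \<mu> k0 x"
    using eventually_reversible[OF mu, of k0] unfolding eventually_at_top_linorder by blast
  show ?thesis
  proof (intro exI[of _ "max 1 X"] conjI allI impI)
    show "max 1 X > 0" by simp
  next
    fix L :: nat and U :: real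
    assume L: "max 1 X \<le> real L" and U: "U \<in> {0<..<pi/4}"
    let ?T = "pi * real L"
    let ?P = "zeta_factorization_points y0 \<mu> U ?T"
    let ?f1 = "\<lambda>t::real. t * (sin t)\<^sup>2" and ?f2 = "\<lambda>t::real. t * (cos t)\<^sup>2" and ?f3 = "\<lambda>t::real. t * cos (2 * t)"
    have "1 * real L \<le> ?T" using pi_gt3 by (intro mult_right_mono) auto
    then have T: "0 < ?T" "X \<le> ?T" using L by linarith+
    have ge: "0 \<le> t" if "t \<in> {?T..?T+U}" for t using that T by auto
    have cos_ge: "0 \<le> cos (2 * t)" if "t \<in> {?T..?T+U}" for t
      unfolding cos_double_shift_pi[of t L] using that U by (intro cos_ge_zero) auto
    \<comment> \<open>The midpoint witnesses that none of the three functions vanishes identically: there the value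
        \<open>cos U\<close> of \<open>cos (2 t)\<close> lies strictly between \<open>0\<close> and \<open>1\<close>.\<close>
    let ?m = "?T + U / 2"
    have m: "?m \<in> {?T..?T+U}" "0 < ?m" using U T by auto
    have cosU: "cos (2 * ?m) = cos U" unfolding cos_double_shift_pi[of ?m L] by simp
    have c: "0 < cos U" "cos U < 1"
      using U cos_monotone_0_pi[of 0 U] by (auto intro!: cos_gt_zero)
    have "(sin ?m)\<^sup>2 \<noteq> 0" using cosU c cos_double_sin[of ?m] by auto
    then have nz1: "\<exists>t\<in>{?T..?T+U}. ?f1 t \<noteq> 0" using m by (intro bexI[of _ ?m]) auto
    have "(cos ?m)\<^sup>2 \<noteq> 0" using cosU c cos_double_cos[of ?m] by auto
    then have nz2: "\<exists>t\<in>{?T..?T+U}. ?f2 t \<noteq> 0" using m by (intro bexI[of _ ?m]) auto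
    have nz3: "\<exists>t\<in>{?T..?T+U}. ?f3 t \<noteq> 0"
      using m c cosU by (intro bexI[of _ ?m]) auto
    have "\<forall>k\<in>{1..k0}. \<exists>\<beta>. (\<exists>\<alpha>. ?P k ?f1 \<alpha> \<beta>) \<and> (\<exists>\<alpha>. ?P k ?f2 \<alpha> \<beta>) \<and> (\<exists>\<alpha>. ?P k ?f3 \<alpha> \<beta>)"
    proof
      fix k assume k: "k \<in> {1..k0}"
      have "0 < U" "reversible y0 \<mu> k ?T"
        using U reversible_mono[OF mu X[OF T(2)]] k by auto
      then obtain \<beta> where \<beta>: "\<And>f. continuous_on {?T..?T+U} f \<Longrightarrow> \<forall>t\<in>{?T..?T+U}. 0 \<le> f t \<Longrightarrow>
          \<exists>t\<in>{?T..?T+U}. f t \<noteq> 0 \<Longrightarrow> \<exists>\<alpha>. ?P k f \<alpha> \<beta>"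
        using common_beta_factorization[OF mu] by meson
      have "\<exists>\<alpha>. ?P k ?f1 \<alpha> \<beta>" using ge nz1 by (intro \<beta>[of ?f1] continuous_intros) auto
      moreover have "\<exists>\<alpha>. ?P k ?f2 \<alpha> \<beta>" using ge nz2 by (intro \<beta>[of ?f2] continuous_intros) auto
      moreover have "\<exists>\<alpha>. ?P k ?f3 \<alpha> \<beta>"
        using ge cos_ge nz3 by (intro \<beta>[of ?f3] continuous_intros) auto
      ultimately show "\<exists>\<beta>. (\<exists>\<alpha>. ?P k ?f1 \<alpha> \<beta>) \<and> (\<exists>\<alpha>. ?P k ?f2 \<alpha> \<beta>) \<and> (\<exists>\<alpha>. ?P k ?f3 \<alpha> \<beta>)"
        by blast
    qed
    from bchoice[OF this] obtain \<beta> where \<beta>: "\<forall>k\<in>{1..k0}. (\<exists>\<alpha>. ?P k ?f1 \<alpha> (\<beta> k)) \<and>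
        (\<exists>\<alpha>. ?P k ?f2 \<alpha> (\<beta> k)) \<and> (\<exists>\<alpha>. ?P k ?f3 \<alpha> (\<beta> k))" ..
    from \<beta> have "\<forall>k\<in>{1..k0}. \<exists>\<alpha>. ?P k ?f1 \<alpha> (\<beta> k)" by blast
    from bchoice[OF this] obtain \<alpha>1 where P1: "\<forall>k\<in>{1..k0}. ?P k ?f1 (\<alpha>1 k) (\<beta> k)" ..
    from \<beta> have "\<forall>k\<in>{1..k0}. \<exists>\<alpha>. ?P k ?f2 \<alpha> (\<beta> k)" by blast
    from bchoice[OF this] obtain \<alpha>2 where P2: "\<forall>k\<in>{1..k0}. ?P k ?f2 (\<alpha>2 k) (\<beta> k)" ..
    from \<beta> have "\<forall>k\<in>{1..k0}. \<exists>\<alpha>. ?P k ?f3 \<alpha> (\<beta> k)" by blast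
    from bchoice[OF this] obtain \<alpha>3 where P3: "\<forall>k\<in>{1..k0}. ?P k ?f3 (\<alpha>3 k) (\<beta> k)" ..
    note P = bspec[OF P1] bspec[OF P2] bspec[OF P3]
    have "integral {?T..?T+U} ?f2 - integral {?T..?T+U} ?f1 = integral {?T..?T+U} (\<lambda>t. ?f2 t - ?f1 t)"
      by (intro integral_diff[symmetric] integrable_continuous_real continuous_intros)
    also have "(\<lambda>t. ?f2 t - ?f1 t) = ?f3"
      by (simp add: cos_double right_diff_distrib)
    finally have int: "integral {?T..?T+U} ?f2 - integral {?T..?T+U} ?f1 = integral {?T..?T+U} ?f3" .
    show "\<exists>(\<alpha>1 :: nat \<Rightarrow> nat \<Rightarrow> real) (\<alpha>2 :: nat \<Rightarrow> nat \<Rightarrow> real) (\<alpha>3 :: nat \<Rightarrow> nat \<Rightarrow> real)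
       (\<beta> :: nat \<Rightarrow> nat \<Rightarrow> real).
      (\<forall>k\<in>{1..k0}.
         zeta_factorization_points y0 \<mu> U (pi * L) k (\<lambda>t. t * (sin t)\<^sup>2) (\<alpha>1 k) (\<beta> k) \<and>
         zeta_factorization_points y0 \<mu> U (pi * L) k (\<lambda>t. t * (cos t)\<^sup>2) (\<alpha>2 k) (\<beta> k) \<and>
         zeta_factorization_points y0 \<mu> U (pi * L) k (\<lambda>t. t * cos (2 * t)) (\<alpha>3 k) (\<beta> k)) \<and>
      (\<forall>k1\<in>{1..k0}. \<forall>k2\<in>{1..k0}. \<forall>k3\<in>{1..k0}.
         (\<alpha>2 k2 0 * (\<Prod>r=1..k2. Ztsq y0 \<mu> (\<alpha>2 k2 r) / Ztsq y0 \<mu> (\<beta> k2 r))) * (cos (\<alpha>2 k2 0))\<^sup>2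
         - (\<alpha>1 k1 0 * (\<Prod>r=1..k1. Ztsq y0 \<mu> (\<alpha>1 k1 r) / Ztsq y0 \<mu> (\<beta> k1 r))) * (sin (\<alpha>1 k1 0))\<^sup>2
         = (\<alpha>3 k3 0 * (\<Prod>r=1..k3. Ztsq y0 \<mu> (\<alpha>3 k3 r) / Ztsq y0 \<mu> (\<beta> k3 r))) * cos (2 * \<alpha>3 k3 0)) \<and>
      (\<forall>\<alpha>\<in>{\<alpha>1, \<alpha>2, \<alpha>3}. \<forall>k\<in>{1..k0}.
         \<alpha> k 0 \<in> {pi * L<..<pi * L + U} \<and>
         (\<forall>r\<in>{1..k}.
            \<alpha> k r \<in> {rev_iter y0 \<mu> r (pi * L)<..<rev_iter y0 \<mu> r (pi * L + U)} \<and>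
            \<beta> k r \<in> {rev_iter y0 \<mu> r (pi * L)<..<rev_iter y0 \<mu> r (pi * L + U)})) \<and>
      (\<forall>k1\<in>{1..k0}. \<forall>k2\<in>{1..k0}. \<forall>k3\<in>{1..k0}.
         \<alpha>1 k1 ` {0..k1} \<union> \<alpha>2 k2 ` {0..k2} \<union> \<alpha>3 k3 ` {0..k3} \<union>
           \<beta> k1 ` {1..k1} \<union> \<beta> k2 ` {1..k2} \<union> \<beta> k3 ` {1..k3}
           \<subseteq> Delta_set y0 \<mu> U (pi * L) (Max {k1, k2, k3}) \<and>
         Delta_set y0 \<mu> U (pi * L) (Max {k1, k2, k3}) \<subseteq> Delta_set y0 \<mu> U (pi * L) k0)"
    proof (rule exI[of _ \<alpha>1], rule exI[of _ \<alpha>2], rule exI[of _ \<alpha>3], rule exI[of _ \<beta>],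
        intro conjI ballI)
      fix k assume "k \<in> {1..k0}"
      then show "?P k ?f1 (\<alpha>1 k) (\<beta> k)" "?P k ?f2 (\<alpha>2 k) (\<beta> k)" "?P k ?f3 (\<alpha>3 k) (\<beta> k)"
        using P by auto
    next
      fix k1 k2 k3 assume k: "k1 \<in> {1..k0}" "k2 \<in> {1..k0}" "k3 \<in> {1..k0}"
      let ?Q = "\<lambda>\<alpha> k. \<Prod>r=1..k. Ztsq y0 \<mu> (\<alpha> k r) / Ztsq y0 \<mu> (\<beta> k r)"
      have "?f2 (\<alpha>2 k2 0) * ?Q \<alpha>2 k2 - ?f1 (\<alpha>1 k1 0) * ?Q \<alpha>1 k1 = ?f3 (\<alpha>3 k3 0) * ?Q \<alpha>3 k3"
        unfolding factorization_value[OF P(1)[OF k(1)]] factorization_value[OF P(2)[OF k(2)]]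
          factorization_value[OF P(3)[OF k(3)]] int[symmetric]
        by (simp add: right_diff_distrib)
      then show "(\<alpha>2 k2 0 * ?Q \<alpha>2 k2) * (cos (\<alpha>2 k2 0))\<^sup>2
          - (\<alpha>1 k1 0 * ?Q \<alpha>1 k1) * (sin (\<alpha>1 k1 0))\<^sup>2
          = (\<alpha>3 k3 0 * ?Q \<alpha>3 k3) * cos (2 * \<alpha>3 k3 0)"
        by (simp only: ac_simps)
      let ?K = "Max {k1, k2, k3}"
      have K: "k1 \<le> ?K" "k2 \<le> ?K" "k3 \<le> ?K" "?K \<le> k0" using k by auto
      show "\<alpha>1 k1 ` {0..k1} \<union> \<alpha>2 k2 ` {0..k2} \<union> \<alpha>3 k3 ` {0..k3} \<union>
           \<beta> k1 ` {1..k1} \<union> \<beta> k2 ` {1..k2} \<union> \<beta> k3 ` {1..k3} \<subseteq> Delta_set y0 \<mu> U ?T ?K"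
        by (intro Un_least factorization_points_in_Delta_set[OF P(1)[OF k(1)] K(1)]
            factorization_points_in_Delta_set[OF P(2)[OF k(2)] K(2)]
            factorization_points_in_Delta_set[OF P(3)[OF k(3)] K(3)])
      show "Delta_set y0 \<mu> U ?T ?K \<subseteq> Delta_set y0 \<mu> U ?T k0"
        using K(4) by (rule Delta_set_mono)
    next
      fix \<alpha> k assume "\<alpha> \<in> {\<alpha>1, \<alpha>2, \<alpha>3}" and k: "k \<in> {1..k0}"
      then obtain f where f: "?P k f (\<alpha> k) (\<beta> k)" using P[OF k] by blast
      show "\<alpha> k 0 \<in> {?T<..<?T + U}" using factorization_points_bounds[OF f] by blast
      fix r assume "r \<in> {1..k}"
      then show "\<alpha> k r \<in> {rev_iter y0 \<mu> r ?T<..<rev_iter y0 \<mu> r (?T + U)}"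
        "\<beta> k r \<in> {rev_iter y0 \<mu> r ?T<..<rev_iter y0 \<mu> r (?T + U)}"
        using factorization_points_bounds[OF f] by blast+
    qed
  qed
qed

end
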